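(* If $a$ is an invertible element of $\mathcal{M}$ such that $a$ and $a^{-1}$ belong to $H^\infty$, then $$\inf\left\{\tau\bigl(|a^*|^2\,|I-f|^2\bigr):\ f\in H^\infty_0\right\}=\tau\bigl(|\Phi(a)|^2\bigr).$$
   Context: $\mathcal{M}$ is a von Neumann algebra on a Hilbert space with unit $I$ and a faithful normal finite trace $\tau$, normalized by $\tau(I)=1$. For $x\in\mathcal{M}$, $|x|^2=x^*x$. $H^\infty$ is a weak$^*$-closed unital subalgebra of $\mathcal{M}$, $(H^\infty)^*=\{x^*: x\in H^\infty\}$, $D=H^\infty\cap(H^\infty)^*$, and $\Phi$ is a faithful normal (conditional) expectation from $\mathcal{M}$ onto $D$. It is assumed that $H^\infty$ is a finite, maximal, subdiagonal algebra with respect to $\Phi$ and $\tau$, i.e.: (1) $H^\infty+(H^\infty)^*$ is weak$^*$-dense in $\mathcal{M}$; (2) $\Phi(ab)=\Phi(a)\Phi(b)$ for all $a,b\in H^\infty$; (3) $H^\infty$ is maximal among the subalgebras satisfying (1) and (2); (4) $\tau\circ\Phi=\tau$. Put $H^\infty_0=\{x\in H^\infty:\Phi(x)=0\}$. *)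

theory Defs
  imports "HOL-Analysis.Analysis"
begin

section \<open>Complex Hilbert spaces\<close>

class complex_vector = real_vector +
  fixes scaleC :: "complex \<Rightarrow> 'a \<Rightarrow> 'a" (infixr "*\<^sub>C" 75)
  assumes scaleC_add_right: "c *\<^sub>C (x + y) = c *\<^sub>C x + c *\<^sub>C y"
    and scaleC_add_left: "(c + d) *\<^sub>C x = c *\<^sub>C x + d *\<^sub>C x"
    and scaleC_scaleC: "c *\<^sub>C d *\<^sub>C x = (c * d) *\<^sub>C x"
    and scaleC_one: "1 *\<^sub>C x = x"
    and scaleC_of_real: "complex_of_real r *\<^sub>C x = r *\<^sub>R x"

text \<open>The inner product is linear in its first argument. Its definiteness, and the fact that
  it induces the norm, are inherited from \<^class>\<open>real_inner\<close>, as the real inner product is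
  required to be its real part.\<close>

class chilbert_space = complex_vector + real_inner + complete_space +
  fixes cinner :: "'a \<Rightarrow> 'a \<Rightarrow> complex"
  assumes cinner_commute: "cinner x y = cnj (cinner y x)"
    and cinner_add_left: "cinner (x + y) z = cinner x z + cinner y z"
    and cinner_scaleC_left: "cinner (c *\<^sub>C x) y = c * cinner x y"
    and inner_eq_Re_cinner: "inner x y = Re (cinner x y)"

instantiation complex :: complex_vector
begin

definition "c *\<^sub>C (z::complex) = c * z"

instance
  by standard (auto simp: scaleC_complex_def algebra_simps scaleR_conv_of_real)

end

definition clinear_on :: "'a::complex_vector set \<Rightarrow> ('a \<Rightarrow> 'b::complex_vector) \<Rightarrow> bool" where
  "clinear_on S f \<longleftrightarrow>
     (\<forall>x\<in>S. \<forall>y\<in>S. f (x + y) = f x + f y) \<and> (\<forall>c. \<forall>x\<in>S. f (c *\<^sub>C x) = c *\<^sub>C f x)"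

lemma scaleC_zero_right [simp]: "c *\<^sub>C (0::'a::complex_vector) = 0"
  by (metis add_cancel_right_right scaleC_add_right add.right_neutral)

lemma scaleC_minus_right: "c *\<^sub>C (- x) = - (c *\<^sub>C (x::'a::complex_vector))"
  by (metis add.right_inverse add_eq_0_iff scaleC_add_right scaleC_zero_right)

lemma cinner_add_right: "cinner x (y + z) = cinner x y + cinner x z"
  by (metis cinner_add_left cinner_commute complex_cnj_add)

lemma cinner_scaleC_right: "cinner x (c *\<^sub>C y) = cnj c * cinner x y"
  by (metis cinner_commute cinner_scaleC_left complex_cnj_mult)

lemma Im_cinner: "Im (cinner x y) = - inner (\<i> *\<^sub>C x) y"
  by (simp add: inner_eq_Re_cinner cinner_scaleC_left)

lemma norm_scaleC: "norm (c *\<^sub>C x) = cmod c * norm (x::'a::chilbert_space)"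
proof -
  have "Im (cinner x x) = 0"
    by (metis cinner_commute complex_cnj cnj.simps(2) equal_neg_zero)
  then have "inner (c *\<^sub>C x) (c *\<^sub>C x) = ((Re c)\<^sup>2 + (Im c)\<^sup>2) * inner x x"
    by (simp add: inner_eq_Re_cinner cinner_scaleC_left cinner_scaleC_right
        power2_eq_square algebra_simps)
  then have "inner (c *\<^sub>C x) (c *\<^sub>C x) = (cmod c)\<^sup>2 * inner x x"
    by (simp only: cmod_power2)
  then show ?thesis
    by (simp add: norm_eq_sqrt_inner real_sqrt_mult)
qed

lemma bounded_linear_scaleC: "bounded_linear (\<lambda>x::'a::chilbert_space. c *\<^sub>C x)"
  by (rule bounded_linear_intro[where K = "cmod c"])
    (simp_all add: scaleC_add_right norm_scaleC scaleC_scaleC mult.commute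
      flip: scaleC_of_real)

lemma riesz_representation:
  fixes f :: "'a::{real_inner, complete_space} \<Rightarrow> real"
  assumes "bounded_linear f"
  shows "\<exists>z. \<forall>x. f x = inner x z"
proof -
  interpret f: bounded_linear f by fact
  define F where "F z = (norm z)\<^sup>2 - 2 * f z" for z
  obtain K where K: "\<And>z. norm (f z) \<le> norm z * K"
    using f.bounded by blast
  have bdd: "bdd_below (range F)"
  proof (rule bdd_belowI2)
    fix z
    have "f z \<le> norm z * K" using K[of z] by simp
    moreover have "0 \<le> (norm z - K)\<^sup>2" by simp
    ultimately show "- K\<^sup>2 \<le> F z"
      by (simp add: F_def power2_eq_square algebra_simps)
  qed
  define m where "m = Inf (range F)"
  have m_le: "m \<le> F z" for z
    unfolding m_def by (rule cInf_lower[OF _ bdd]) simp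
  have "\<exists>z. F z < m + inverse (Suc n)" for n
    using cInf_lessD[of "range F" "m + inverse (Suc n)"]
    by (auto simp: m_def simp del: of_nat_Suc)
  then obtain z where z: "\<And>n. F (z n) < m + inverse (Suc n)" by metis
  have par: "(norm (x - y))\<^sup>2 = 2 * F x + 2 * F y - 4 * F ((1/2) *\<^sub>R (x + y))" for x y
    by (simp add: F_def f.add f.scaleR power2_norm_eq_inner inner_diff_left inner_diff_right
        inner_add_left inner_add_right inner_commute algebra_simps)
  have dist: "(norm (z i - z j))\<^sup>2 \<le> 2 * inverse (Suc i) + 2 * inverse (Suc j)" for i j
    using par[of "z i" "z j"] z[of i] z[of j] m_le[of "(1/2) *\<^sub>R (z i + z j)"] by linarith
  have "Cauchy z"
  proof (rule CauchyI)
    fix e :: real assume "0 < e"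
    then obtain N where N: "inverse (Suc N) < e\<^sup>2 / 4"
      using reals_Archimedean[of "e\<^sup>2 / 4"] by auto
    have "norm (z i - z j) < e" if "N \<le> i" "N \<le> j" for i j
    proof -
      have "inverse (real (Suc i)) \<le> inverse (Suc N)" "inverse (real (Suc j)) \<le> inverse (Suc N)"
        using that by (simp_all add: le_imp_inverse_le)
      then have "(norm (z i - z j))\<^sup>2 < e\<^sup>2"
        using dist[of i j] N by linarith
      then show ?thesis
        using \<open>0 < e\<close> by (simp add: power2_less_imp_less)
    qed
    then show "\<exists>M. \<forall>i\<ge>M. \<forall>j\<ge>M. norm (z i - z j) < e" by blast
  qed
  then obtain l where l: "z \<longlonglongrightarrow> l"
    by (auto simp: Cauchy_convergent_iff convergent_def)
  have "(\<lambda>n. F (z n)) \<longlonglongrightarrow> F l"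
    unfolding F_def by (intro tendsto_intros f.tendsto l)
  moreover have "(\<lambda>n. m + inverse (real (Suc n))) \<longlonglongrightarrow> m + 0"
    by (intro tendsto_intros LIMSEQ_inverse_real_of_nat)
  ultimately have "F l \<le> m + 0"
    by (rule LIMSEQ_le) (meson less_imp_le z)
  then have min: "F l \<le> F x" for x
    using m_le[of x] by linarith
  have "f x = inner x l" for x
  proof -
    define c where "c = f x - inner x l"
    have "F (l + t *\<^sub>R x) - F l = t * t * inner x x - 2 * t * c" for t
      by (simp add: F_def c_def f.add f.scaleR power2_norm_eq_inner inner_add_left inner_add_right
          inner_commute algebra_simps)
    then have "2 * t * c \<le> t\<^sup>2 * inner x x" for t
      using min[of "l + t *\<^sub>R x"] by (metis diff_ge_0_iff_ge power2_eq_square)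
    from this[of "c / (1 + inner x x)"]
    have "2 * (c\<^sup>2 / (1 + inner x x)) \<le> c\<^sup>2 * inner x x / (1 + inner x x)\<^sup>2"
      by (simp add: power_divide power2_eq_square)
    moreover have "c\<^sup>2 * inner x x / (1 + inner x x)\<^sup>2 \<le> c\<^sup>2 / (1 + inner x x)"
    proof -
      have pos: "0 < 1 + inner x x"
        using inner_ge_zero[of x] by linarith
      have "c\<^sup>2 * inner x x / (1 + inner x x)\<^sup>2
          = (c\<^sup>2 / (1 + inner x x)) * (inner x x / (1 + inner x x))"
        by (simp add: power2_eq_square)
      also have "\<dots> \<le> (c\<^sup>2 / (1 + inner x x)) * 1"
        using pos by (intro mult_left_mono) auto
      finally show ?thesis by simp
    qed
    ultimately have "c\<^sup>2 / (1 + inner x x) \<le> 0" by linarith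
    moreover have "0 < 1 + inner x x"
      using inner_ge_zero[of x] by linarith
    ultimately have "c\<^sup>2 \<le> 0" by (simp add: divide_le_0_iff)
    then show ?thesis by (simp add: c_def)
  qed
  then show ?thesis by blast
qed

section \<open>Bounded operators\<close>

typedef (overloaded) 'h bop =
  "{T :: 'h::chilbert_space \<Rightarrow> 'h. bounded_linear T \<and> (\<forall>c x. T (c *\<^sub>C x) = c *\<^sub>C T x)}"
  morphisms app Bop
  by (rule exI[of _ "\<lambda>x. x"]) simp

setup_lifting type_definition_bop

lemma bop_eqI: "(\<And>x. app S x = app T x) \<Longrightarrow> S = T"
  by transfer auto

instantiation bop :: (chilbert_space) "{ring, monoid_mult, complex_vector}"
begin

lift_definition zero_bop :: "'a bop" is "\<lambda>x. 0" by simp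

lift_definition one_bop :: "'a bop" is "\<lambda>x. x" by simp

lift_definition plus_bop :: "'a bop \<Rightarrow> 'a bop \<Rightarrow> 'a bop" is "\<lambda>S T x. S x + T x"
  by (simp add: bounded_linear_add scaleC_add_right)

lift_definition uminus_bop :: "'a bop \<Rightarrow> 'a bop" is "\<lambda>T x. - T x"
  by (simp add: bounded_linear_minus scaleC_minus_right)

definition minus_bop :: "'a bop \<Rightarrow> 'a bop \<Rightarrow> 'a bop" where "minus_bop S T = S + - T"

lift_definition times_bop :: "'a bop \<Rightarrow> 'a bop \<Rightarrow> 'a bop" is "\<lambda>S T x. S (T x)"
  by (simp add: bounded_linear_compose)

lift_definition scaleC_bop :: "complex \<Rightarrow> 'a bop \<Rightarrow> 'a bop" is "\<lambda>c T x. c *\<^sub>C T x"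
  by (simp add: bounded_linear_compose[OF bounded_linear_scaleC] scaleC_scaleC mult.commute)

definition scaleR_bop :: "real \<Rightarrow> 'a bop \<Rightarrow> 'a bop" where
  "scaleR_bop r T = complex_of_real r *\<^sub>C T"

instance
proof
  fix R S T :: "'a bop" and r s :: real and c d :: complex
  have add: "app T (x + y) = app T x + app T y" for T :: "'a bop" and x y
    by transfer (simp add: linear_add bounded_linear.linear)
  show "R + S + T = R + (S + T)" by transfer (simp add: add.assoc)
  show "S + T = T + S" by transfer (simp add: add.commute)
  show "0 + T = T" by transfer simp
  show "- T + T = 0" by transfer simp
  show "S - T = S + - T" by (fact minus_bop_def)
  show "R * S * T = R * (S * T)" by transfer simp
  show "(R + S) * T = R * T + S * T" by transfer simp
  show "R * (S + T) = R * S + R * T"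
    by (rule bop_eqI) (simp add: times_bop.rep_eq plus_bop.rep_eq add)
  show "1 * T = T" by transfer simp
  show "T * 1 = T" by transfer simp
  show C1: "c *\<^sub>C (S + T) = c *\<^sub>C S + c *\<^sub>C T" for c and S T :: "'a bop"
    by transfer (simp add: scaleC_add_right)
  show C2: "(c + d) *\<^sub>C T = c *\<^sub>C T + d *\<^sub>C T" for c d and T :: "'a bop"
    by transfer (simp add: scaleC_add_left)
  show C3: "c *\<^sub>C d *\<^sub>C T = (c * d) *\<^sub>C T" for c d and T :: "'a bop"
    by transfer (simp add: scaleC_scaleC)
  show C4: "1 *\<^sub>C T = T" for T :: "'a bop" by transfer (simp add: scaleC_one)
  show "complex_of_real r *\<^sub>C T = r *\<^sub>R T" by (simp add: scaleR_bop_def)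
  show "r *\<^sub>R (S + T) = r *\<^sub>R S + r *\<^sub>R T" by (simp add: scaleR_bop_def C1)
  show "(r + s) *\<^sub>R T = r *\<^sub>R T + s *\<^sub>R T" by (simp add: scaleR_bop_def C2)
  show "r *\<^sub>R s *\<^sub>R T = (r * s) *\<^sub>R T" by (simp add: scaleR_bop_def C3)
  show "1 *\<^sub>R T = T" by (simp add: scaleR_bop_def C4)
qed

end

definition adj :: "'h::chilbert_space bop \<Rightarrow> 'h bop" where
  "adj T = (THE S. \<forall>x y. cinner (app T x) y = cinner x (app S y))"

lemma cinner_eqI:
  assumes "\<And>x. cinner x y = cinner x (z::'h::chilbert_space)"
  shows "y = z"
proof -
  have "inner (y - z) y = inner (y - z) z"
    by (simp add: inner_eq_Re_cinner assms)
  then have "inner (y - z) (y - z) = 0" by (simp add: inner_diff_right)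
  then show ?thesis by simp
qed

lemma adj_exists: "\<exists>S. \<forall>x y. cinner (app T x) y = cinner x (app S y)"
proof -
  have T: "bounded_linear (app T)" and Tc: "app T (c *\<^sub>C x) = c *\<^sub>C app T x" for c x
    using app[of T] by auto
  have "\<exists>z. \<forall>x. inner (app T x) y = inner x z" for y
    using T by (intro riesz_representation bounded_linear_compose[OF bounded_linear_inner_left])
  then obtain g where g: "inner (app T x) y = inner x (g y)" for x y by metis
  have gc: "cinner (app T x) y = cinner x (g y)" for x y
  proof (rule complex_eqI)
    show "Re (cinner (app T x) y) = Re (cinner x (g y))"
      using g[of x y] by (simp add: inner_eq_Re_cinner)
    show "Im (cinner (app T x) y) = Im (cinner x (g y))"
      by (simp add: Im_cinner g flip: Tc)
  qed
  have g_add: "g (y + z) = g y + g z" for y z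
    by (rule cinner_eqI) (simp add: cinner_add_right flip: gc)
  have g_scaleC: "g (c *\<^sub>C y) = c *\<^sub>C g y" for c y
    by (rule cinner_eqI) (simp add: cinner_scaleC_right flip: gc)
  obtain K where K: "\<And>x. norm (app T x) \<le> norm x * K"
    using bounded_linear.bounded[OF T] by blast
  have "norm (g y) \<le> norm y * K" for y
  proof (cases "g y = 0")
    case True
    have "0 \<le> norm (app T y)" by simp
    also have "\<dots> \<le> norm y * K" by (rule K)
    finally show ?thesis using True by simp
  next
    case False
    have "norm (g y) * norm (g y) = inner (app T (g y)) y"
      by (simp add: g power2_norm_eq_inner flip: power2_eq_square)
    also have "\<dots> \<le> norm (app T (g y)) * norm y"
      by (rule norm_cauchy_schwarz)
    also have "\<dots> \<le> norm (g y) * (norm y * K)"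
      using mult_right_mono[OF K[of "g y"], of "norm y"] by (simp add: mult_ac)
    finally show ?thesis using False by simp
  qed
  then have "bounded_linear g"
    by (intro bounded_linear_intro[where K = K])
      (simp_all add: g_add g_scaleC flip: scaleC_of_real)
  then have "app (Bop g) = g" by (simp add: Bop_inverse g_scaleC)
  then show ?thesis using gc by metis
qed

lemma cinner_adj: "cinner (app T x) y = cinner x (app (adj T) y)"
proof -
  have "\<exists>!S. \<forall>x y. cinner (app T x) y = cinner x (app S y)"
  proof (rule ex_ex1I[OF adj_exists])
    fix S R
    assume "\<forall>x y. cinner (app T x) y = cinner x (app S y)"
      and "\<forall>x y. cinner (app T x) y = cinner x (app R y)"
    then have "cinner x (app S y) = cinner x (app R y)" for x y by metis
    then show "S = R" by (intro bop_eqI cinner_eqI)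
  qed
  from theI'[OF this] show ?thesis unfolding adj_def by blast
qed

definition positive_op :: "'h::chilbert_space bop \<Rightarrow> bool" where
  "positive_op T \<longleftrightarrow> (\<forall>x. cinner (app T x) x \<in> \<real>\<^sub>\<ge>\<^sub>0)"

text \<open>The square of the modulus, \<open>|T|\<^sup>2 = T\<^sup>* T\<close>.\<close>

definition abs_sq :: "'h::chilbert_space bop \<Rightarrow> 'h bop" where
  "abs_sq T = adj T * T"

section \<open>Von Neumann algebras\<close>

definition subalgebra :: "'h::chilbert_space bop set \<Rightarrow> bool" where
  "subalgebra A \<longleftrightarrow> 0 \<in> A \<and> (\<forall>x\<in>A. \<forall>y\<in>A. x + y \<in> A) \<and> (\<forall>c. \<forall>x\<in>A. c *\<^sub>C x \<in> A) \<and>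
     (\<forall>x\<in>A. \<forall>y\<in>A. x * y \<in> A)"

definition commutant :: "'h::chilbert_space bop set \<Rightarrow> 'h bop set" where
  "commutant S = {T. \<forall>x\<in>S. T * x = x * T}"

definition von_neumann_algebra :: "'h::chilbert_space bop set \<Rightarrow> bool" where
  "von_neumann_algebra M \<longleftrightarrow>
     subalgebra M \<and> 1 \<in> M \<and> (\<forall>x\<in>M. adj x \<in> M) \<and> commutant (commutant M) = M"

text \<open>The ultraweak (sigma-weak) topology is the initial topology for the functionals
  \<open>T \<mapsto> \<Sum>n. \<langle>T \<xi>\<^sub>n, \<eta>\<^sub>n\<rangle>\<close> with square-summable \<open>\<xi>\<close> and \<open>\<eta>\<close>. Its restriction to a von Neumann
  algebra is the weak* topology given by the predual.\<close>

definition ultraweak :: "'h::chilbert_space bop topology" where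
  "ultraweak = topology_generated_by
     {{T. (\<Sum>n. cinner (app T (\<xi> n)) (\<eta> n)) \<in> U} | \<xi> \<eta> U.
        summable (\<lambda>n. (norm (\<xi> n))\<^sup>2) \<and> summable (\<lambda>n. (norm (\<eta> n))\<^sup>2) \<and> open U}"

abbreviation weak_star :: "'h::chilbert_space bop set \<Rightarrow> 'h bop topology" where
  "weak_star M \<equiv> subtopology ultraweak M"

text \<open>A finite trace is identified with the linear functional on \<open>M\<close> that extends it.\<close>

definition faithful_normal_finite_trace ::
    "'h::chilbert_space bop set \<Rightarrow> ('h bop \<Rightarrow> complex) \<Rightarrow> bool" where
  "faithful_normal_finite_trace M \<tau> \<longleftrightarrow>
     clinear_on M \<tau> \<and>
     (\<forall>x\<in>M. positive_op x \<longrightarrow> \<tau> x \<in> \<real>\<^sub>\<ge>\<^sub>0) \<and>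
     (\<forall>x\<in>M. \<forall>y\<in>M. \<tau> (x * y) = \<tau> (y * x)) \<and>
     (\<forall>x\<in>M. positive_op x \<and> \<tau> x = 0 \<longrightarrow> x = 0) \<and>
     continuous_map (weak_star M) euclidean \<tau>"

definition faithful_normal_expectation ::
    "'h::chilbert_space bop set \<Rightarrow> 'h bop set \<Rightarrow> ('h bop \<Rightarrow> 'h bop) \<Rightarrow> bool" where
  "faithful_normal_expectation M D \<Phi> \<longleftrightarrow>
     clinear_on M \<Phi> \<and> \<Phi> ` M = D \<and>
     (\<forall>d\<in>D. \<Phi> d = d) \<and>
     (\<forall>x\<in>M. positive_op x \<longrightarrow> positive_op (\<Phi> x)) \<and>
     (\<forall>x\<in>M. \<forall>d\<in>D. \<forall>e\<in>D. \<Phi> (d * x * e) = d * \<Phi> x * e) \<and>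
     (\<forall>x\<in>M. positive_op x \<and> \<Phi> x = 0 \<longrightarrow> x = 0) \<and>
     continuous_map (weak_star M) (weak_star D) \<Phi>"

section \<open>Subdiagonal algebras\<close>

definition weak_star_closed_unital_subalgebra ::
    "'h::chilbert_space bop set \<Rightarrow> 'h bop set \<Rightarrow> bool" where
  "weak_star_closed_unital_subalgebra M H \<longleftrightarrow>
     H \<subseteq> M \<and> subalgebra H \<and> 1 \<in> H \<and> closedin (weak_star M) H"

definition subdiagonal ::
    "'h::chilbert_space bop set \<Rightarrow> ('h bop \<Rightarrow> 'h bop) \<Rightarrow> 'h bop set \<Rightarrow> bool" where
  "subdiagonal M \<Phi> A \<longleftrightarrow>
     subalgebra A \<and> A \<subseteq> M \<and>
     (weak_star M) closure_of {x + adj y | x y. x \<in> A \<and> y \<in> A} = M \<and>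
     (\<forall>a\<in>A. \<forall>b\<in>A. \<Phi> (a * b) = \<Phi> a * \<Phi> b)"

definition finite_maximal_subdiagonal ::
    "'h::chilbert_space bop set \<Rightarrow> ('h bop \<Rightarrow> complex) \<Rightarrow> ('h bop \<Rightarrow> 'h bop) \<Rightarrow> 'h bop set \<Rightarrow> bool"
    where
  "finite_maximal_subdiagonal M \<tau> \<Phi> H \<longleftrightarrow>
     subdiagonal M \<Phi> H \<and>
     (\<forall>A. subdiagonal M \<Phi> A \<and> H \<subseteq> A \<longrightarrow> A = H) \<and>
     (\<forall>x\<in>M. \<tau> (\<Phi> x) = \<tau> x)"

end

theory Submission
  imports Defs
begin

text \<open>Put \<open>g = (I - f) a\<close> for \<open>f \<in> H\<^sub>0\<close>. By traciality the functional to be minimized is \<open>\<tau>(|g|\<^sup>2)\<close>, and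
  multiplicativity of \<open>\<Phi>\<close> on \<open>H\<close> gives \<open>\<Phi>(g) = \<Phi>(a)\<close>. Since \<open>\<Phi>\<close> is the orthogonal projection onto
  \<open>D\<close> for the inner product of \<open>\<tau>\<close>, Pythagoras yields
  \<open>\<tau>(|g|\<^sup>2) = \<tau>(|\<Phi>(a)|\<^sup>2) + \<tau>(|g - \<Phi>(a)|\<^sup>2) \<ge> \<tau>(|\<Phi>(a)|\<^sup>2)\<close>, with equality for
  \<open>f = I - \<Phi>(a) a\<^sup>-\<^sup>1\<close>.\<close>

text \<open>Inner products separate points, so the defining identity determines the operator. Since
  \<open>adj\<close> is a definite description, its algebraic rules are all derived from
  this.\<close>

lemma adj_unique:
  assumes "\<And>x y. cinner (app T x) y = cinner x (app S y)"
  shows "adj T = S"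
  by (rule bop_eqI, rule cinner_eqI) (simp add: assms flip: cinner_adj)

lemma adj_adj [simp]: "adj (adj T) = T"
  by (rule adj_unique) (metis cinner_adj cinner_commute)

lemma adj_one [simp]: "adj 1 = 1"
  by (rule adj_unique) (simp add: one_bop.rep_eq)

lemma adj_add: "adj (S + T) = adj S + adj T"
  by (rule adj_unique)
    (simp add: plus_bop.rep_eq cinner_add_left cinner_add_right cinner_adj)

lemma adj_mult: "adj (S * T) = adj T * adj S"
  by (rule adj_unique) (simp add: times_bop.rep_eq cinner_adj)

lemma adj_scaleC: "adj (c *\<^sub>C T) = cnj c *\<^sub>C adj T"
  by (rule adj_unique)
    (simp add: scaleC_bop.rep_eq cinner_scaleC_left cinner_scaleC_right cinner_adj)

lemma bop_scaleC_mult_left: "(c *\<^sub>C S) * T = c *\<^sub>C (S * T)"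
  for S T :: "'h::chilbert_space bop"
  by (rule bop_eqI) (simp add: times_bop.rep_eq scaleC_bop.rep_eq)

lemma bop_scaleC_mult_right: "S * (c *\<^sub>C T) = c *\<^sub>C (S * T)"
  for S T :: "'h::chilbert_space bop"
  by (rule bop_eqI) (use app in \<open>auto simp: times_bop.rep_eq scaleC_bop.rep_eq\<close>)

text \<open>\<open>subalgebra\<close> and \<open>clinear_on\<close> speak only of sums and complex
  multiples; differences are reached through the scalar -1.\<close>

lemma scaleC_minus_one: "(- 1) *\<^sub>C x = - (x::'a::complex_vector)"
  using scaleC_of_real[of "- 1" x] by simp

lemma cinner_self_nonneg: "cinner x x \<in> \<real>\<^sub>\<ge>\<^sub>0"
proof -
  have "Im (cinner x x) = 0"
    by (metis cinner_commute complex_cnj cnj.simps(2) equal_neg_zero)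
  moreover have "0 \<le> Re (cinner x x)"
    by (simp flip: inner_eq_Re_cinner)
  ultimately show ?thesis
    by (simp add: complex_nonneg_Reals_iff)
qed

text \<open>Moving the outer adjoint across the inner product turns
  \<open>cinner (app (adj T * T) x) x\<close> into
  \<open>cinner (app T x) (app T x)\<close>.\<close>

lemma positive_op_abs_sq: "positive_op (abs_sq T)"
  unfolding positive_op_def abs_sq_def
  by (metis adj_adj cinner_adj cinner_self_nonneg times_bop.rep_eq)

lemma subalgebra_diff:
  assumes "subalgebra A" "x \<in> A" "y \<in> A"
  shows "x - y \<in> A"
proof -
  have "x + (- 1) *\<^sub>C y \<in> A"
    using assms unfolding subalgebra_def by blast
  then show ?thesis by (simp add: scaleC_minus_one)
qed

lemma clinear_on_diff:
  assumes "clinear_on A f" "subalgebra A" "x \<in> A" "y \<in> A"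
  shows "f (x - y) = f x - f y"
proof -
  have "(- 1) *\<^sub>C y \<in> A"
    using assms unfolding subalgebra_def by blast
  then have "f (x + (- 1) *\<^sub>C y) = f x + (- 1) *\<^sub>C f y"
    using assms unfolding clinear_on_def by metis
  then show ?thesis by (simp only: scaleC_minus_one) simp
qed

text \<open>Positivity of \<open>\<tau>\<close> forces \<open>(x, y) \<mapsto> \<tau>(y\<^sup>* x)\<close> to be hermitian, so orthogonality is symmetric:
  expand \<open>\<tau>(|d + h|\<^sup>2)\<close> and \<open>\<tau>(|d + \<i> h|\<^sup>2)\<close>, which are real.\<close>

lemma trace_abs_sq_add_orthogonal:
  fixes \<tau> :: "'h::chilbert_space bop \<Rightarrow> complex"
  assumes M: "subalgebra M" "\<And>x. x \<in> M \<Longrightarrow> adj x \<in> M"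
    and lin: "clinear_on M \<tau>"
    and pos: "\<And>x. x \<in> M \<Longrightarrow> positive_op x \<Longrightarrow> \<tau> x \<in> \<real>\<^sub>\<ge>\<^sub>0"
    and d: "d \<in> M" and h: "h \<in> M" and orth: "\<tau> (adj d * h) = 0"
  shows "\<tau> (abs_sq (d + h)) = \<tau> (abs_sq d) + \<tau> (abs_sq h)"
proof -
  have mult: "x * y \<in> M" and add: "x + y \<in> M" and scaleC: "c *\<^sub>C x \<in> M"
    if "x \<in> M" "y \<in> M" for x y c
    using M(1) that unfolding subalgebra_def by blast+
  have \<tau>_add: "\<tau> (x + y) = \<tau> x + \<tau> y" and \<tau>_scaleC: "\<tau> (c *\<^sub>C x) = c * \<tau> x"
    if "x \<in> M" "y \<in> M" for x y c
    using lin that unfolding clinear_on_def scaleC_complex_def by blast+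
  have real: "Im (\<tau> (abs_sq x)) = 0" if "x \<in> M" for x
    using pos[OF _ positive_op_abs_sq] that mult M(2)
    by (simp add: abs_sq_def complex_nonneg_Reals_iff)
  have expand: "\<tau> (abs_sq (d + k)) = \<tau> (abs_sq d) + \<tau> (adj d * k) + \<tau> (adj k * d) + \<tau> (abs_sq k)"
    if "k \<in> M" for k
  proof -
    have "abs_sq (d + k) = (adj d * d + adj d * k) + (adj k * d + adj k * k)"
      by (simp add: abs_sq_def adj_add algebra_simps)
    then show ?thesis
      using that d M(2) by (simp add: \<tau>_add mult add abs_sq_def)
  qed
  have ih: "\<i> *\<^sub>C h \<in> M" using scaleC h by blast
  have "Im (\<tau> (adj h * d)) = 0"
    using expand[OF h] real[OF add[OF d h]] real[OF d] real[OF h] orth by simp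
  moreover have "\<tau> (adj d * (\<i> *\<^sub>C h)) = 0"
    using orth mult[OF M(2)[OF d] h] by (simp add: bop_scaleC_mult_right \<tau>_scaleC)
  then have "Im (\<tau> (adj (\<i> *\<^sub>C h) * d)) = 0"
    using expand[OF ih] real[OF add[OF d ih]] real[OF d] real[OF ih] by simp
  \<comment> \<open>The adjoint of \<open>\<i> *\<^sub>C h\<close> carries the factor -\<i>, which
    turns the imaginary part just computed into minus the real part sought.\<close>
  then have "Re (\<tau> (adj h * d)) = 0"
    using mult[OF M(2)[OF h] d] by (simp add: adj_scaleC bop_scaleC_mult_left \<tau>_scaleC)
  ultimately have "\<tau> (adj h * d) = 0"
    by (simp add: complex_eq_iff)
  then show ?thesis using expand[OF h] orth by simp
qed

theorem proposition2:
  fixes M D H :: "'h::chilbert_space bop set"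
    and \<tau> :: "'h bop \<Rightarrow> complex"
    and \<Phi> :: "'h bop \<Rightarrow> 'h bop"
    and a a_inv :: "'h bop"
  assumes "von_neumann_algebra M"
    and "faithful_normal_finite_trace M \<tau>"
    and "\<tau> 1 = 1"
    and "weak_star_closed_unital_subalgebra M H"
    and "D = H \<inter> adj ` H"
    and "faithful_normal_expectation M D \<Phi>"
    and "finite_maximal_subdiagonal M \<tau> \<Phi> H"
    and "a \<in> M" and "a_inv \<in> M" and "a * a_inv = 1" and "a_inv * a = 1"
    and "a \<in> H" and "a_inv \<in> H"
  shows "complex_of_real (INF f\<in>{x \<in> H. \<Phi> x = 0}. Re (\<tau> (abs_sq (adj a) * abs_sq (1 - f))))
           = \<tau> (abs_sq (\<Phi> a))"
proof -
  let ?F = "\<lambda>f. Re (\<tau> (abs_sq (adj a) * abs_sq (1 - f)))"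
  have M_sub: "subalgebra M" and M_adj: "\<And>x. x \<in> M \<Longrightarrow> adj x \<in> M"
    using assms(1) unfolding von_neumann_algebra_def by blast+
  have M_mult: "x * y \<in> M" if "x \<in> M" "y \<in> M" for x y
    using M_sub that unfolding subalgebra_def by blast
  have lin: "clinear_on M \<tau>" and comm: "\<And>x y. x \<in> M \<Longrightarrow> y \<in> M \<Longrightarrow> \<tau> (x * y) = \<tau> (y * x)"
    and pos: "\<And>x. x \<in> M \<Longrightarrow> positive_op x \<Longrightarrow> \<tau> x \<in> \<real>\<^sub>\<ge>\<^sub>0"
    using assms(2) unfolding faithful_normal_finite_trace_def by blast+
  have HM: "H \<subseteq> M" and H: "subalgebra H" and H1: "1 \<in> H"
    using assms(4) unfolding weak_star_closed_unital_subalgebra_def by blast+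
  have H_mult: "x * y \<in> H" if "x \<in> H" "y \<in> H" for x y
    using H that unfolding subalgebra_def by blast
  have D_adj: "adj d \<in> D" if "d \<in> D" for d
    using that assms(5) by auto
  have D1: "1 \<in> D"
    using assms(5) H1 by (metis IntI adj_one imageI)
  have \<Phi>lin: "clinear_on M \<Phi>" and \<Phi>_D: "\<And>x. x \<in> M \<Longrightarrow> \<Phi> x \<in> D"
    and \<Phi>_id: "\<And>d. d \<in> D \<Longrightarrow> \<Phi> d = d"
    and bimod: "\<And>x d e. x \<in> M \<Longrightarrow> d \<in> D \<Longrightarrow> e \<in> D \<Longrightarrow> \<Phi> (d * x * e) = d * \<Phi> x * e"
    using assms(6) unfolding faithful_normal_expectation_def by blast+
  have \<Phi>_mult: "\<And>x y. x \<in> H \<Longrightarrow> y \<in> H \<Longrightarrow> \<Phi> (x * y) = \<Phi> x * \<Phi> y"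
    and \<tau>\<Phi>: "\<And>x. x \<in> M \<Longrightarrow> \<tau> (\<Phi> x) = \<tau> x"
    using assms(7) unfolding finite_maximal_subdiagonal_def subdiagonal_def by blast+
  have DH: "D \<subseteq> H" using assms(5) by blast
  define d where "d = \<Phi> a"
  have dD: "d \<in> D" using \<Phi>_D assms(8) by (simp add: d_def)
  have dH: "d \<in> H" and dM: "d \<in> M" using dD DH HM by auto
  have \<tau>_sq_pos: "\<tau> (abs_sq x) \<in> \<real>\<^sub>\<ge>\<^sub>0" if "x \<in> M" for x
    using that by (intro pos positive_op_abs_sq) (simp add: abs_sq_def M_mult M_adj)
  \<comment> \<open>Here \<open>abs_sq (adj a)\<close> is \<open>a * adj a\<close>; the trace
    property carries the leading \<open>a\<close> to the far right.\<close>
  have F_eq: "\<tau> (abs_sq (adj a) * abs_sq (1 - f)) = \<tau> (abs_sq ((1 - f) * a))" if "f \<in> H" for f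
  proof -
    define u where "u = 1 - f"
    have "u \<in> M" using subalgebra_diff[OF H H1 that] HM by (auto simp: u_def)
    then have "\<tau> (a * (adj a * adj u * u)) = \<tau> (adj a * adj u * u * a)"
      by (intro comm M_mult M_adj assms(8))
    then show ?thesis
      by (simp add: abs_sq_def adj_mult mult.assoc flip: u_def)
  qed
  have lower: "Re (\<tau> (abs_sq d)) \<le> ?F f" if "f \<in> {x \<in> H. \<Phi> x = 0}" for f
  proof -
    have f: "f \<in> H" "\<Phi> f = 0" using that by auto
    have u: "1 - f \<in> H" by (rule subalgebra_diff[OF H H1 f(1)])
    define g where "g = (1 - f) * a"
    have gM: "g \<in> M" using H_mult[OF u assms(12)] HM by (auto simp: g_def)
    have "\<Phi> (1 - f) = 1"
      using clinear_on_diff[OF \<Phi>lin M_sub, of 1 f] H1 f HM \<Phi>_id[OF D1] by auto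
    then have "\<Phi> g = d"
      using \<Phi>_mult[OF u assms(12)] by (simp add: g_def d_def)
    define h where "h = g - d"
    have hM: "h \<in> M" using subalgebra_diff[OF M_sub gM dM] by (simp add: h_def)
    have "\<Phi> h = 0"
      using clinear_on_diff[OF \<Phi>lin M_sub gM dM] \<open>\<Phi> g = d\<close> \<Phi>_id[OF dD] by (simp add: h_def)
    \<comment> \<open>\<open>D\<close> is closed under adjoints, so \<open>adj d\<close> can be
      pulled out of \<Phi>; the right-hand factor of the bimodule law is taken to be 1.\<close>
    then have "\<Phi> (adj d * h) = 0"
      using bimod[OF hM D_adj[OF dD] D1] by simp
    moreover have "\<tau> 0 = 0"
      using clinear_on_diff[OF lin M_sub dM dM] by simp
    ultimately have "\<tau> (adj d * h) = 0"
      using \<tau>\<Phi>[OF M_mult[OF M_adj[OF dM] hM]] by simp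
    then have "\<tau> (abs_sq (d + h)) = \<tau> (abs_sq d) + \<tau> (abs_sq h)"
      by (intro trace_abs_sq_add_orthogonal[OF M_sub M_adj lin pos dM hM])
    then show ?thesis
      using \<tau>_sq_pos[OF hM] F_eq[OF f(1)]
      by (simp add: h_def g_def complex_nonneg_Reals_iff)
  qed
  \<comment> \<open>Chosen so that \<open>(1 - f\<^sub>0) * a = d * a_inv * a = d\<close>, which
    makes the remainder \<open>h\<close> vanish.\<close>
  define f\<^sub>0 where "f\<^sub>0 = 1 - d * a_inv"
  have da: "d * a_inv \<in> H" by (rule H_mult[OF dH assms(13)])
  have f\<^sub>0H: "f\<^sub>0 \<in> H" using subalgebra_diff[OF H H1 da] by (simp add: f\<^sub>0_def)
  \<comment> \<open>Both sides equal \<open>\<Phi> a * \<Phi> a_inv\<close>, because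
    \<open>a_inv\<close> lies in \<open>H\<close> and \<Phi> fixes \<open>d\<close>. As
    \<open>a * a_inv = 1\<close>, the common value is \<open>\<Phi> 1 = 1\<close>.\<close>
  have "\<Phi> (d * a_inv) = \<Phi> (a * a_inv)"
    using \<Phi>_mult[OF dH assms(13)] \<Phi>_mult[OF assms(12,13)] \<Phi>_id[OF dD] by (simp add: d_def)
  then have "\<Phi> f\<^sub>0 = 0"
    using clinear_on_diff[OF \<Phi>lin M_sub, of 1 "d * a_inv"] H1 da HM assms(10)
    by (auto simp: f\<^sub>0_def)
  moreover have "?F f\<^sub>0 = Re (\<tau> (abs_sq d))"
    using F_eq[OF f\<^sub>0H] assms(11) by (simp add: f\<^sub>0_def mult.assoc)
  \<comment> \<open>The lower bound is attained at \<open>f\<^sub>0\<close>, so the infimum is a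
    minimum.\<close>
  ultimately have "(INF f\<in>{x \<in> H. \<Phi> x = 0}. ?F f) = Re (\<tau> (abs_sq d))"
    using lower f\<^sub>0H by (intro cInf_eq_minimum) (auto intro!: image_eqI[where x = f\<^sub>0])
  \<comment> \<open>The trace of \<open>abs_sq d\<close> is real, so nothing is lost in passing to
    real parts.\<close>
  then show ?thesis
    using \<tau>_sq_pos[OF dM] by (simp add: d_def complex_nonneg_Reals_iff complex_eq_iff)
qed

end
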